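(* Let $\mathcal{M}$ be an interactive mechanism answering linear queries that is $(\varepsilon,0,\kappa)$-partial differentially private and $(\alpha,\beta)$-sample accurate. Suppose each linear query $q_t$ depends on at most $\hat m$ samples. Then for every data distribution $\mathcal{P}$, every adversary $\mathcal{A}$, and every $\eta>0$, $$\Pr_{S\sim\mathcal{P}^m,\ \Pi\sim I(\mathcal{M},\mathcal{A};S)}\left[\max_t|a_t-q_t(\mathcal{P}^m)|>\alpha+\frac{\hat m}{m}(e^\varepsilon-1)+\frac{\kappa}{m}+\frac1m\sqrt{2\hat m\ln(2/\eta)}\right]\le\beta+\eta.$$
   Context: Setting. A dataset $S\in\mathcal{X}^m$ is held by a mechanism $\mathcal{M}$, where $\mathcal{X}$ is countable. An adversary $\mathcal{A}$ adaptively issues linear queries $q_t$ and $\mathcal{M}$ answers $a_t$. The transcript $\Pi$ takes values in $\mathbf{\Pi}$, with distribution $I(\mathcal{M},\mathcal{A};S)$. Linear queries. A linear query is $q(S)=\frac1m\sum_iq_i(S_i)$ with $q_i:\mathcal{X}\to[0,1]$. "Depends on at most $\hat m$ samples" means $q_t(S)$ is determined by the coordinates of $S$ in a set of at most $\hat m$ indices. Write $q(\mathcal{P}^m)=\mathbb{E}_{S\sim\mathcal{P}^m}q(S)$. Partial differential privacy. $(\varepsilon,\delta,\kappa)$-partial DP means there is $f_L:\mathbf{\Pi}\to2^{[m]}$ with $\max_\pi|f_L(\pi)|\le\kappa$ such that, for every $\mathcal{A}$, every index $i$, every $S,S'$ differing only at $i$, and every event $E$ with $i\notin\bigcup_{\pi\in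 E}f_L(\pi)$, $$\Pr_{I(\mathcal{M},\mathcal{A};S)}[\Pi\in E]\le e^\varepsilon\Pr_{I(\mathcal{M},\mathcal{A};S')}[\Pi\in E]+\delta.$$ Here $\delta=0$. Sample accuracy. $(\alpha,\beta)$-sample accurate means $$\Pr_{S\sim\mathcal{P}^m,\ \Pi\sim I(\mathcal{M},\mathcal{A};S)}[\max_t|a_t-q_t(S)|\ge\alpha]\le\beta.$$ *)

theory Defs
  imports "HOL-Probability.Probability"
begin

text \<open>
  The sample indices are the elements of a finite type \<open>'n\<close>, so the number of samples is
  \<open>CARD('n)\<close>. Since \<open>'x\<close> is countable, the Borel sigma-algebra on queries is
  generated by the evaluations \<open>q \<mapsto> q i x\<close>.
\<close>

type_synonym ('n, 'x) dataset = "'n \<Rightarrow> 'x"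
type_synonym ('n, 'x) query = "'n \<Rightarrow> 'x \<Rightarrow> real"
type_synonym ('n, 'x) transcript = "nat \<Rightarrow> ('n, 'x) query \<times> real"

definition linear_queries :: "('n::finite, 'x) query set" where
  "linear_queries = {q. \<forall>i x. q i x \<in> {0..1}}"

definition query_value :: "('n::finite, 'x) query \<Rightarrow> ('n, 'x) dataset \<Rightarrow> real" where
  "query_value q S = 1 / real CARD('n) * (\<Sum>i\<in>UNIV. q i (S i))"

definition depends_on_at_most :: "nat \<Rightarrow> ('n::finite, 'x) query \<Rightarrow> bool" where
  "depends_on_at_most k q \<longleftrightarrow>
     (\<exists>J. card J \<le> k \<and>
        (\<forall>S S'. (\<forall>j\<in>J. S j = S' j) \<longrightarrow> query_value q S = query_value q S'))"

definition iid_samples :: "'x pmf \<Rightarrow> ('n::finite, 'x) dataset pmf" where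
  "iid_samples P = Pi_pmf UNIV undefined (\<lambda>_. P)"

definition population_value :: "('n::finite, 'x) query \<Rightarrow> 'x pmf \<Rightarrow> real" where
  "population_value q P = measure_pmf.expectation (iid_samples P) (query_value q)"

text \<open>
  \<open>Q\<close> is the class of queries that the adversary may issue. A transcript of \<open>t\<close> rounds
  lists the pairs of query and answer of the rounds \<open>0, \<dots>, t - 1\<close>.
\<close>

definition query_space :: "('n::finite, 'x::countable) query set \<Rightarrow> ('n, 'x) query measure" where
  "query_space Q = restrict_space borel Q"

definition transcript_space ::
  "('n::finite, 'x::countable) query set \<Rightarrow> nat \<Rightarrow> ('n, 'x) transcript measure" where
  "transcript_space Q t = PiM {..<t} (\<lambda>_. query_space Q \<Otimes>\<^sub>M borel)"

text \<open>
  A mechanism may keep an internal state that is not part of the transcript; it sees the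
  dataset only when the state is initialised (the state may simply store it).
\<close>

record ('n, 'x, 's) mechanism =
  state_space :: "'s measure"
  init_state :: "('n, 'x) dataset \<Rightarrow> 's measure"
  answer :: "'s \<Rightarrow> ('n, 'x) query \<Rightarrow> (real \<times> 's) measure"

definition is_mechanism ::
  "('n::finite, 'x::countable) query set \<Rightarrow> ('n, 'x, 's) mechanism \<Rightarrow> bool" where
  "is_mechanism Q M \<longleftrightarrow>
     (\<forall>S. init_state M S \<in> space (prob_algebra (state_space M))) \<and>
     (\<lambda>(s, q). answer M s q) \<in>
       state_space M \<Otimes>\<^sub>M query_space Q \<rightarrow>\<^sub>M prob_algebra (borel \<Otimes>\<^sub>M state_space M)"

text \<open>
  An adversary maps the transcript so far to a distribution of the next query. Private
  randomness kept between rounds adds nothing: if \<open>Q\<close> is a Borel set, conditioning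
  it on the transcript yields an adversary of this form with the same distribution of transcripts.
\<close>

type_synonym ('n, 'x) adversary = "nat \<Rightarrow> ('n, 'x) transcript \<Rightarrow> ('n, 'x) query measure"

definition is_adversary ::
  "('n::finite, 'x::countable) query set \<Rightarrow> ('n, 'x) adversary \<Rightarrow> bool" where
  "is_adversary Q A \<longleftrightarrow> (\<forall>t. A t \<in> transcript_space Q t \<rightarrow>\<^sub>M prob_algebra (query_space Q))"

primrec run ::
  "('n::finite, 'x::countable) query set \<Rightarrow> ('n, 'x, 's) mechanism \<Rightarrow> ('n, 'x) adversary \<Rightarrow>
   ('n, 'x) dataset \<Rightarrow> nat \<Rightarrow> (('n, 'x) transcript \<times> 's) measure" where
  "run Q M A S 0 =
     init_state M S \<bind> (\<lambda>s.
       return (transcript_space Q 0 \<Otimes>\<^sub>M state_space M) (\<lambda>_. undefined, s))"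
| "run Q M A S (Suc t) =
     run Q M A S t \<bind> (\<lambda>(h, s).
       A t h \<bind> (\<lambda>q.
         answer M s q \<bind> (\<lambda>(a, s').
           return (transcript_space Q (Suc t) \<Otimes>\<^sub>M state_space M) (h(t := (q, a)), s'))))"

definition interaction ::
  "('n::finite, 'x::countable) query set \<Rightarrow> nat \<Rightarrow> ('n, 'x, 's) mechanism \<Rightarrow>
   ('n, 'x) adversary \<Rightarrow> ('n, 'x) dataset \<Rightarrow> ('n, 'x) transcript measure" where
  "interaction Q T M A S = distr (run Q M A S T) (transcript_space Q T) fst"

definition sample_and_interact ::
  "('n::finite, 'x::countable) query set \<Rightarrow> nat \<Rightarrow> ('n, 'x, 's) mechanism \<Rightarrow>
   ('n, 'x) adversary \<Rightarrow> 'x pmf \<Rightarrow> (('n, 'x) dataset \<times> ('n, 'x) transcript) measure" where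
  "sample_and_interact Q T M A P =
     measure_pmf (iid_samples P) \<bind> (\<lambda>S.
       interaction Q T M A S \<bind> (\<lambda>\<pi>.
         return (count_space UNIV \<Otimes>\<^sub>M transcript_space Q T) (S, \<pi>)))"

text \<open>
  Measurability of \<open>f\<close> is essential when transcripts are not discrete: otherwise there
  may be no event of positive probability to which the privacy inequality applies.
\<close>

definition partial_DP ::
  "('n::finite, 'x::countable) query set \<Rightarrow> nat \<Rightarrow> ('n, 'x, 's) mechanism \<Rightarrow>
   real \<Rightarrow> real \<Rightarrow> nat \<Rightarrow> bool" where
  "partial_DP Q T M \<epsilon> \<delta> \<kappa> \<longleftrightarrow>
     (\<exists>f :: ('n, 'x) transcript \<Rightarrow> 'n set.
        f \<in> transcript_space Q T \<rightarrow>\<^sub>M count_space UNIV \<and>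
        (\<forall>\<pi>\<in>space (transcript_space Q T). card (f \<pi>) \<le> \<kappa>) \<and>
        (\<forall>A i S S' E.
           is_adversary Q A \<longrightarrow> (\<forall>j. j \<noteq> i \<longrightarrow> S j = S' j) \<longrightarrow>
           E \<in> sets (transcript_space Q T) \<longrightarrow> i \<notin> (\<Union>\<pi>\<in>E. f \<pi>) \<longrightarrow>
           measure (interaction Q T M A S) E
             \<le> exp \<epsilon> * measure (interaction Q T M A S') E + \<delta>))"

definition sample_accurate ::
  "('n::finite, 'x::countable) query set \<Rightarrow> nat \<Rightarrow> ('n, 'x, 's) mechanism \<Rightarrow>
   real \<Rightarrow> real \<Rightarrow> bool" where
  "sample_accurate Q T M \<alpha> \<beta> \<longleftrightarrow>
     (\<forall>P A. is_adversary Q A \<longrightarrow>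
        \<P>((S, \<pi>) in sample_and_interact Q T M A P.
           (MAX t\<in>{..<T}. \<bar>snd (\<pi> t) - query_value (fst (\<pi> t)) S\<bar>) \<ge> \<alpha>) \<le> \<beta>)"

end

theory Submission
  imports Defs
begin

text \<open>
  Fix a transcript \<open>\<pi>\<close> and let \<open>w S\<close> be the density at \<open>\<pi>\<close> of the law of the transcript on the
  dataset \<open>S\<close>, relative to the mixture of these laws. Partial privacy says that changing a
  coordinate outside \<open>f \<pi>\<close> changes \<open>w\<close> at most by the factor \<open>exp \<epsilon>\<close>. Under the posterior, whose
  density with respect to \<open>P\<^sup>m\<close> is proportional to \<open>w\<close>, the conditional mean of \<open>q\<^sub>i (S\<^sub>i)\<close> given
  other coordinates therefore differs from its mean under \<open>P\<close> by at most \<open>exp \<epsilon> - 1\<close>, or by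
  at most \<open>1\<close> if \<open>i \<in> f \<pi>\<close>. Integrating out the coordinates one at a time with Hoeffding's lemma,
  as in the proof of Azuma's inequality, bounds the posterior probability that a query chosen
  depending on \<open>\<pi>\<close> deviates from its population value. Apply this to a query whose answer is
  far from its population value, and integrate over \<open>\<pi>\<close>.
\<close>

section \<open>Exponential moments of bounded functions under tilted product distributions\<close>

text \<open>Hoeffding's lemma applies to the distribution \<open>\<nu>\<close> with density
  \<open>W / I\<close> with respect to \<open>P\<close>, centred at its own mean \<open>m\<close>.
  The ratio hypothesis caps this density by \<open>K\<close>, so \<open>m\<close> exceeds the mean
  under \<open>P\<close> by at most \<open>K - 1\<close>, and moving the centre costs the factor
  \<open>exp (l * (K - 1))\<close>. Only an upper bound on the shift is proved; the lower tail is
  reached later by reflecting the query.\<close>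

lemma nn_integral_exp_centred_tilted_le:
  fixes P :: "'x pmf" and W :: "'x \<Rightarrow> ennreal" and \<phi> :: "'x \<Rightarrow> real"
  assumes \<phi>: "\<And>x. \<phi> x \<in> {0..1}" and l: "l > 0" and K: "K \<ge> 1"
    and ratio: "\<And>x y. x \<in> set_pmf P \<Longrightarrow> y \<in> set_pmf P \<Longrightarrow> W x \<le> ennreal K * W y"
  shows "(\<integral>\<^sup>+x. ennreal (exp (l * (\<phi> x - measure_pmf.expectation P \<phi>))) * W x \<partial>P)
           \<le> ennreal (exp (l * (K - 1) + l\<^sup>2 / 8)) * (\<integral>\<^sup>+x. W x \<partial>P)"
proof -
  define \<mu> where "\<mu> = measure_pmf.expectation P \<phi>"
  define I where "I = (\<integral>\<^sup>+x. W x \<partial>P)"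
  have int: "integrable P \<phi>"
    by (rule measure_pmf.integrable_const_bound[where B = 1]) (use \<phi> in auto)
  have \<mu>: "0 \<le> \<mu>" "\<mu> \<le> 1"
    unfolding \<mu>_def using \<phi> int
    by (auto intro!: integral_nonneg measure_pmf.integral_le_const)
  consider "I = \<infinity>" | "I = 0" | "I \<noteq> 0" "I \<noteq> \<infinity>" by blast
  then show ?thesis
  proof cases
    case 1
    then show ?thesis by (simp add: I_def ennreal_mult_top)
  next
    case 2
    then have "AE x in P. W x = 0"
      unfolding I_def by (subst (asm) nn_integral_0_iff_AE) auto
    then have "(\<integral>\<^sup>+x. ennreal (exp (l * (\<phi> x - \<mu>))) * W x \<partial>P) = 0"
      by (subst nn_integral_0_iff_AE) auto
    then show ?thesis by (simp add: \<mu>_def)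
  next
    case 3
    define \<nu> where "\<nu> = density (measure_pmf P) (\<lambda>x. W x / I)"
    have I_div: "I * (W x / I) = W x" for x
      using 3 mult_divide_eq_ennreal[of I "W x"] by (simp add: ennreal_times_divide mult.commute)
    have "emeasure \<nu> (space \<nu>) = (\<integral>\<^sup>+x. W x / I \<partial>P)"
      by (simp add: \<nu>_def emeasure_density)
    also have "\<dots> = 1"
      using 3 by (simp add: nn_integral_divide I_def[symmetric] less_top[symmetric])
    finally interpret \<nu>: prob_space \<nu> by (rule prob_spaceI)
    interpret \<nu>: interval_bounded_random_variable \<nu> \<phi> 0 1
      by unfold_locales (use \<phi> in \<open>auto simp: \<nu>_def\<close>)
    define m where "m = \<nu>.expectation \<phi>"
    \<comment> \<open>Averaging the ratio hypothesis over \<open>y\<close> replaces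
      \<open>W y\<close> by the normalising constant \<open>I\<close>.\<close>
    have W_le: "W x / I \<le> ennreal K" if "x \<in> set_pmf P" for x
    proof -
      have "W x = (\<integral>\<^sup>+y. W x \<partial>P)" by simp
      also have "\<dots> \<le> (\<integral>\<^sup>+y. ennreal K * W y \<partial>P)"
        using ratio that by (intro nn_integral_mono_AE) (auto simp: AE_measure_pmf_iff)
      also have "\<dots> = ennreal K * I" by (simp add: nn_integral_cmult I_def)
      finally show ?thesis
        using 3 by (auto intro!: divide_le_posI_ennreal simp: mult.commute zero_less_iff_neq_zero)
    qed
    have "ennreal m = (\<integral>\<^sup>+x. ennreal (\<phi> x) \<partial>\<nu>)"
      unfolding m_def using \<phi> \<nu>.integrable by (intro nn_integral_eq_integral[symmetric]) auto
    also have "\<dots> = (\<integral>\<^sup>+x. W x / I * ennreal (\<phi> x) \<partial>P)"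
      unfolding \<nu>_def by (simp add: nn_integral_density)
    also have "\<dots> \<le> (\<integral>\<^sup>+x. ennreal K * ennreal (\<phi> x) \<partial>P)"
      using W_le by (intro nn_integral_mono_AE) (auto simp: AE_measure_pmf_iff intro!: mult_right_mono)
    also have "\<dots> = ennreal K * ennreal \<mu>"
      unfolding \<mu>_def using \<phi> int by (simp add: nn_integral_cmult nn_integral_eq_integral)
    also have "\<dots> = ennreal (K * \<mu>)" using K \<mu> by (simp add: ennreal_mult)
    finally have "m \<le> K * \<mu>" using K \<mu> by (simp add: ennreal_le_iff)
    moreover have "(K - 1) * \<mu> \<le> K - 1"
      using K \<mu> by (simp add: mult_left_le)
    ultimately have m_le: "m - \<mu> \<le> K - 1" by (simp add: algebra_simps)
    \<comment> \<open>The exponential is split at \<open>m\<close>: one factor is the constant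
      shift, the other is the centred exponential that Hoeffding's lemma bounds under
      \<open>\<nu>\<close>.\<close>
    have "(\<integral>\<^sup>+x. ennreal (exp (l * (\<phi> x - \<mu>))) * W x \<partial>P)
        = (\<integral>\<^sup>+x. W x / I * (I * ennreal (exp (l * (m - \<mu>))) * ennreal (exp (l * (\<phi> x - m)))) \<partial>P)"
    proof (intro nn_integral_cong)
      fix x
      have "ennreal (exp (l * (\<phi> x - \<mu>))) = ennreal (exp (l * (m - \<mu>))) * ennreal (exp (l * (\<phi> x - m)))"
        by (simp add: ennreal_mult[symmetric] exp_add[symmetric] algebra_simps)
      then show "ennreal (exp (l * (\<phi> x - \<mu>))) * W x
        = W x / I * (I * ennreal (exp (l * (m - \<mu>))) * ennreal (exp (l * (\<phi> x - m))))"
        using I_div[of x] by (metis mult.assoc mult.commute)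
    qed
    also have "\<dots> = (\<integral>\<^sup>+x. I * ennreal (exp (l * (m - \<mu>))) * ennreal (exp (l * (\<phi> x - m))) \<partial>\<nu>)"
      unfolding \<nu>_def by (subst nn_integral_density) auto
    also have "\<dots> = I * ennreal (exp (l * (m - \<mu>))) * (\<integral>\<^sup>+x. ennreal (exp (l * (\<phi> x - m))) \<partial>\<nu>)"
      by (intro nn_integral_cmult) auto
    also have "\<dots> \<le> I * ennreal (exp (l * (K - 1))) * ennreal (exp (l\<^sup>2 / 8))"
      using \<nu>.Hoeffdings_lemma_nn_integral[OF l] m_le l
      by (intro mult_mono) (auto simp: m_def intro!: ennreal_leI)
    also have "\<dots> = ennreal (exp (l * (K - 1) + l\<^sup>2 / 8)) * I"
      by (simp add: exp_add ennreal_mult mult_ac)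
    finally show ?thesis by (simp add: I_def \<mu>_def)
  qed
qed

text \<open>Coordinates are integrated out one at a time. Integrating a weight over some coordinates
  keeps its ratio bounds in the others, and this produces new weights, so \<open>step\<close> is
  assumed for arbitrary \<open>W\<close>. For indices in \<open>F\<close> there is no ratio bound,
  and \<open>step\<close> must hold unconditionally.\<close>

lemma nn_integral_Pi_pmf_prod_le:
  fixes P :: "'i \<Rightarrow> 'x pmf" and h :: "'i \<Rightarrow> 'x \<Rightarrow> ennreal" and C :: "'i \<Rightarrow> ennreal"
    and K :: ennreal and F :: "'i set"
  assumes "finite A"
    and step: "\<And>i W. i \<in> A \<Longrightarrow>
        (\<And>x y. i \<notin> F \<Longrightarrow> x \<in> set_pmf (P i) \<Longrightarrow> y \<in> set_pmf (P i) \<Longrightarrow> W x \<le> K * W y) \<Longrightarrow>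
        (\<integral>\<^sup>+x. h i x * W x \<partial>P i) \<le> C i * (\<integral>\<^sup>+x. W x \<partial>P i)"
    and ratio: "\<And>i S x y. i \<in> A \<Longrightarrow> i \<notin> F \<Longrightarrow> S \<in> PiE_dflt A d (set_pmf \<circ> P) \<Longrightarrow> x \<in> set_pmf (P i) \<Longrightarrow>
        y \<in> set_pmf (P i) \<Longrightarrow> w (S(i := x)) \<le> K * w (S(i := y))"
  shows "(\<integral>\<^sup>+S. (\<Prod>i\<in>A. h i (S i)) * w S \<partial>Pi_pmf A d P) \<le> (\<Prod>i\<in>A. C i) * (\<integral>\<^sup>+S. w S \<partial>Pi_pmf A d P)"
  using assms
proof (induction A arbitrary: w rule: finite_induct)
  case empty
  then show ?case by simp
next
  case (insert a A)
  have ins: "Pi_pmf (insert a A) d P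
      = P a \<bind> (\<lambda>x. map_pmf (\<lambda>S. S(a := x)) (Pi_pmf A d P))"
    using insert.hyps
    by (simp add: Pi_pmf_insert pair_pmf_def map_bind_pmf bind_return_pmf map_pmf_def bind_assoc_pmf)
  have mem: "S(a := x) \<in> PiE_dflt (insert a A) d (set_pmf \<circ> P)"
    if "S \<in> PiE_dflt A d (set_pmf \<circ> P)" "x \<in> set_pmf (P a)" for S x
    using that by (auto simp: PiE_dflt_def)
  define W where "W x = (\<integral>\<^sup>+S. w (S(a := x)) \<partial>Pi_pmf A d P)" for x
  \<comment> \<open>With coordinate \<open>a\<close> frozen at \<open>x\<close>, the induction
    hypothesis is used for the weight sending \<open>S\<close> to \<open>w (S(a := x))\<close>;
    updates at \<open>a\<close> and at an index of \<open>A\<close> commute.\<close>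
  have inner: "(\<integral>\<^sup>+S. (\<Prod>i\<in>A. h i (S i)) * w (S(a := x)) \<partial>Pi_pmf A d P) \<le> (\<Prod>i\<in>A. C i) * W x"
    if x: "x \<in> set_pmf (P a)" for x
    unfolding W_def
  proof (rule insert.IH)
    fix i S y z
    assume *: "i \<in> A" "i \<notin> F" "S \<in> PiE_dflt A d (set_pmf \<circ> P)" "y \<in> set_pmf (P i)" "z \<in> set_pmf (P i)"
    then have "a \<noteq> i" using insert.hyps by auto
    have "w ((S(a := x))(i := y)) \<le> K * w ((S(a := x))(i := z))"
      by (rule insert.prems(2)[OF _ *(2) mem[OF *(3) x] *(4,5)]) (use *(1) in blast)
    then show "w (S(i := y, a := x)) \<le> K * w (S(i := z, a := x))"
      by (simp only: fun_upd_twist[OF \<open>a \<noteq> i\<close>])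
  qed (use insert.prems(1) in auto)
  have ratioW: "W x \<le> K * W y" if "a \<notin> F" "x \<in> set_pmf (P a)" "y \<in> set_pmf (P a)" for x y
  proof -
    have "W x \<le> (\<integral>\<^sup>+S. K * w (S(a := y)) \<partial>Pi_pmf A d P)"
      unfolding W_def
    proof (intro nn_integral_mono_AE, unfold AE_measure_pmf_iff, intro ballI)
      fix S assume "S \<in> set_pmf (Pi_pmf A d P)"
      then have S: "S \<in> PiE_dflt A d (set_pmf \<circ> P)"
        using insert.hyps by (simp add: set_Pi_pmf)
      \<comment> \<open>\<open>S\<close> has the default \<open>d\<close> at \<open>a\<close>, which
        may lie outside the support, so the ratio hypothesis is applied at the base point
        \<open>S(a := x)\<close>.\<close>
      have "w ((S(a := x))(a := x)) \<le> K * w ((S(a := x))(a := y))"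
        by (rule insert.prems(2)[OF _ that(1) mem[OF S that(2)] that(2,3)]) simp
      then show "w (S(a := x)) \<le> K * w (S(a := y))" by (simp only: fun_upd_upd)
    qed
    then show ?thesis by (simp add: W_def nn_integral_cmult)
  qed
  have "(\<integral>\<^sup>+S. (\<Prod>i\<in>insert a A. h i (S i)) * w S \<partial>Pi_pmf (insert a A) d P)
      = (\<integral>\<^sup>+x. h a x * (\<integral>\<^sup>+S. (\<Prod>i\<in>A. h i (S i)) * w (S(a := x)) \<partial>Pi_pmf A d P) \<partial>P a)"
  proof -
    have "(\<Prod>i\<in>A. h i ((S(a := x)) i)) = (\<Prod>i\<in>A. h i (S i))" for S x
      using insert.hyps by (intro prod.cong) auto
    then show ?thesis
      using insert.hyps
      by (simp add: ins nn_integral_cmult[symmetric] mult.assoc del: fun_upd_apply) simp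
  qed
  also have "\<dots> \<le> (\<integral>\<^sup>+x. (\<Prod>i\<in>A. C i) * (h a x * W x) \<partial>P a)"
  proof (intro nn_integral_mono_AE, unfold AE_measure_pmf_iff, intro ballI)
    fix x assume "x \<in> set_pmf (P a)"
    from mult_left_mono[OF inner[OF this], of "h a x"]
    show "h a x * (\<integral>\<^sup>+S. (\<Prod>i\<in>A. h i (S i)) * w (S(a := x)) \<partial>Pi_pmf A d P)
        \<le> (\<Prod>i\<in>A. C i) * (h a x * W x)"
      by (simp add: mult_ac)
  qed
  also have "\<dots> = (\<Prod>i\<in>A. C i) * (\<integral>\<^sup>+x. h a x * W x \<partial>P a)"
    by (simp add: nn_integral_cmult)
  also have "\<dots> \<le> (\<Prod>i\<in>A. C i) * (C a * (\<integral>\<^sup>+x. W x \<partial>P a))"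
    using ratioW by (intro mult_left_mono insert.prems(1)) auto
  also have "\<dots> = (\<Prod>i\<in>insert a A. C i) * (\<integral>\<^sup>+S. w S \<partial>Pi_pmf (insert a A) d P)"
    using insert.hyps by (simp add: ins W_def mult_ac)
  finally show ?case .
qed

text \<open>This is a Chernoff bound for an unnormalised weight. The bias is at most
  \<open>K - 1\<close> for a coordinate outside \<open>F\<close> and at most \<open>1\<close> for
  one in \<open>F\<close>, in total at most \<open>k * (K - 1) + \<kappa>\<close>; \<open>s\<close>
  is the fluctuation beyond that.\<close>

lemma nn_integral_iid_samples_deviation_le:
  fixes \<phi> :: "('n::finite, 'x) query" and w :: "('n, 'x) dataset \<Rightarrow> ennreal"
  assumes \<phi>: "\<And>i x. \<phi> i x \<in> {0..1}" and K: "K \<ge> 1" and J: "card J \<le> k" and F: "card F \<le> \<kappa>"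
    and k: "k > 0" and s: "s > 0"
    and ratio: "\<And>i S x y. i \<notin> F \<Longrightarrow> S \<in> set_pmf (iid_samples P) \<Longrightarrow> x \<in> set_pmf P \<Longrightarrow>
        y \<in> set_pmf P \<Longrightarrow> w (S(i := x)) \<le> ennreal K * w (S(i := y))"
  shows "(\<integral>\<^sup>+S. indicator {S. (\<Sum>i\<in>J. \<phi> i (S i) - measure_pmf.expectation P (\<phi> i))
              > real k * (K - 1) + real \<kappa> + s} S * w S \<partial>iid_samples P)
           \<le> ennreal (exp (- s\<^sup>2 / (2 * real k))) * (\<integral>\<^sup>+S. w S \<partial>iid_samples P)"
proof -
  \<comment> \<open>The optimal value for \<open>- l * s + k * l\<^sup>2 / 8\<close> would be
    \<open>4 * s / k\<close>. The simpler choice leaves the exponent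
    \<open>- 7 * s\<^sup>2 / (8 * k)\<close>, which suffices.\<close>
  define l where "l = s / real k"
  have l: "l > 0" using k s by (simp add: l_def)
  define \<mu> where "\<mu> i = measure_pmf.expectation P (\<phi> i)" for i
  define B where "B = real k * (K - 1) + real \<kappa>"
  define b where "b i = (if i \<in> F then 1 else K - 1)" for i
  define h where "h i x = (if i \<in> J then ennreal (exp (l * (\<phi> i x - \<mu> i))) else 1)" for i x
  define C where "C i = (if i \<in> J then ennreal (exp (l * b i + l\<^sup>2 / 8)) else 1)" for i
  have prod_J: "(\<Prod>i\<in>UNIV. if i \<in> J then ennreal (exp (f i)) else 1) = ennreal (exp (\<Sum>i\<in>J. f i))"
    for f :: "'n \<Rightarrow> real"
    by (simp add: prod.If_cases exp_sum prod_ennreal)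
  have int: "integrable P (\<phi> i)" for i
    by (rule measure_pmf.integrable_const_bound[where B = 1]) (use \<phi> in auto)
  have \<mu>: "0 \<le> \<mu> i" for i
    unfolding \<mu>_def using \<phi> by (auto intro!: integral_nonneg)
  have step: "(\<integral>\<^sup>+x. h i x * W x \<partial>P) \<le> C i * (\<integral>\<^sup>+x. W x \<partial>P)"
    if "\<And>x y. i \<notin> F \<Longrightarrow> x \<in> set_pmf P \<Longrightarrow> y \<in> set_pmf P \<Longrightarrow> W x \<le> ennreal K * W y" for i W
  proof (cases "i \<in> J \<and> i \<notin> F")
    case True
    with that nn_integral_exp_centred_tilted_le[of "\<phi> i" l K P W] \<phi> l K show ?thesis
      by (simp add: h_def C_def b_def \<mu>_def)
  next
    case False
    \<comment> \<open>Outside \<open>J\<close> both sides are \<open>1\<close>; in \<open>F\<close>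
      no ratio is available, but the centred value never exceeds \<open>1\<close>.\<close>
    have "h i x \<le> C i" for x
    proof -
      have "l * (\<phi> i x - \<mu> i) \<le> l * 1"
        using l \<phi>[of i x] \<mu>[of i] by (intro mult_left_mono) auto
      then have "l * (\<phi> i x - \<mu> i) \<le> l + l\<^sup>2 / 8"
        using zero_le_power2[of l] by linarith
      then show ?thesis using False by (auto simp: h_def C_def b_def intro!: ennreal_leI)
    qed
    then have "(\<integral>\<^sup>+x. h i x * W x \<partial>P) \<le> (\<integral>\<^sup>+x. C i * W x \<partial>P)"
      by (intro nn_integral_mono mult_right_mono) auto
    then show ?thesis by (simp add: nn_integral_cmult)
  qed
  have "(\<integral>\<^sup>+S. indicator {S. (\<Sum>i\<in>J. \<phi> i (S i) - \<mu> i) > B + s} S * w S \<partial>iid_samples P)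
      \<le> (\<integral>\<^sup>+S. ennreal (exp (- l * (B + s))) * ((\<Prod>i\<in>UNIV. h i (S i)) * w S) \<partial>iid_samples P)"
  proof (intro nn_integral_mono)
    fix S
    \<comment> \<open>Markov's inequality in pointwise form, with the threshold moved into the
      exponent.\<close>
    have "(indicator {S. (\<Sum>i\<in>J. \<phi> i (S i) - \<mu> i) > B + s} S :: ennreal)
        \<le> ennreal (exp (- l * (B + s))) * ennreal (exp (\<Sum>i\<in>J. l * (\<phi> i (S i) - \<mu> i)))"
    proof (cases "(\<Sum>i\<in>J. \<phi> i (S i) - \<mu> i) > B + s")
      case True
      then have "0 \<le> - l * (B + s) + (\<Sum>i\<in>J. l * (\<phi> i (S i) - \<mu> i))"
        using l by (simp add: sum_distrib_left[symmetric])
      then have "1 \<le> ennreal (exp (- l * (B + s) + (\<Sum>i\<in>J. l * (\<phi> i (S i) - \<mu> i))))"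
        by (simp add: one_le_exp_iff del: ennreal_1 flip: ennreal_1)
      with True show ?thesis by (simp add: ennreal_mult[symmetric] exp_add[symmetric])
    qed simp
    then show "indicator {S. (\<Sum>i\<in>J. \<phi> i (S i) - \<mu> i) > B + s} S * w S
        \<le> ennreal (exp (- l * (B + s))) * ((\<Prod>i\<in>UNIV. h i (S i)) * w S)"
      unfolding h_def prod_J mult.assoc[symmetric] by (rule mult_right_mono) simp
  qed
  also have "\<dots> \<le> ennreal (exp (- l * (B + s))) * ((\<Prod>i\<in>UNIV. C i) * (\<integral>\<^sup>+S. w S \<partial>iid_samples P))"
    unfolding iid_samples_def
    by (subst nn_integral_cmult, simp, intro mult_left_mono nn_integral_Pi_pmf_prod_le[where F = F and K = K])
       (use step ratio in \<open>auto simp: iid_samples_def set_Pi_pmf\<close>)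
  also have "\<dots> = ennreal (exp (- l * (B + s) + (\<Sum>i\<in>J. l * b i + l\<^sup>2 / 8))) * (\<integral>\<^sup>+S. w S \<partial>iid_samples P)"
    unfolding C_def prod_J unfolding exp_add by (simp add: ennreal_mult mult.assoc)
  also have "\<dots> \<le> ennreal (exp (- s\<^sup>2 / (2 * real k))) * (\<integral>\<^sup>+S. w S \<partial>iid_samples P)"
  proof (intro mult_right_mono ennreal_leI, subst exp_le_cancel_iff)
    have "(\<Sum>i\<in>J. b i) \<le> (\<Sum>i\<in>J. (K - 1) + (if i \<in> F then 1 else 0))"
      using K by (intro sum_mono) (auto simp: b_def)
    also have "\<dots> = real (card J) * (K - 1) + real (card (J \<inter> F))"
      by (simp add: sum.distrib sum.If_cases)
    also have "\<dots> \<le> B"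
    proof -
      have "card (J \<inter> F) \<le> \<kappa>" using F card_mono[of F "J \<inter> F"] by simp
      then show ?thesis unfolding B_def using J K by (intro add_mono mult_right_mono) auto
    qed
    finally have "l * (\<Sum>i\<in>J. b i) \<le> l * B" using l by simp
    \<comment> \<open>In terms of \<open>r\<close> the remaining estimate is linear:
      \<open>- r + r / 8 \<le> - r / 2\<close>.\<close>
    moreover define r where "r = s\<^sup>2 / real k"
    moreover have "real (card J) * (l\<^sup>2 / 8) \<le> real k * (l\<^sup>2 / 8)"
      using J by (intro mult_right_mono) auto
    moreover have "l * s = r" "real k * (l\<^sup>2 / 8) = r / 8" "r \<ge> 0"
      using k by (simp_all add: r_def l_def power2_eq_square)
    ultimately have "l * (\<Sum>i\<in>J. b i) + real (card J) * (l\<^sup>2 / 8) - l * B - l * s \<le> - r / 2"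
      by linarith
    moreover have "- l * (B + s) + (\<Sum>i\<in>J. l * b i + l\<^sup>2 / 8)
        = l * (\<Sum>i\<in>J. b i) + real (card J) * (l\<^sup>2 / 8) - l * B - l * s"
      by (simp add: sum.distrib sum_distrib_left algebra_simps)
    moreover have "- s\<^sup>2 / (2 * real k) = - r / 2" by (simp add: r_def)
    ultimately show "- l * (B + s) + (\<Sum>i\<in>J. l * b i + l\<^sup>2 / 8) \<le> - s\<^sup>2 / (2 * real k)"
      by (simp only:)
  qed simp
  finally show ?thesis by (simp add: B_def \<mu>_def)
qed

section \<open>Deviation of a single linear query from its population value\<close>

lemma population_value_eq:
  fixes q :: "('n::finite, 'x) query"
  assumes "q \<in> linear_queries"
  shows "population_value q P = 1 / real CARD('n) * (\<Sum>i\<in>UNIV. measure_pmf.expectation P (q i))"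
proof -
  have "measure_pmf.expectation (iid_samples P) (\<lambda>S. q i (S i)) = measure_pmf.expectation P (q i)" for i
  proof -
    have "P = map_pmf (\<lambda>S. S i) (iid_samples P :: ('n, 'x) dataset pmf)"
      by (simp add: iid_samples_def Pi_pmf_component)
    then show ?thesis by (metis integral_map_pmf)
  qed
  moreover have "integrable (iid_samples P) (\<lambda>S. q i (S i))" for i
    by (rule measure_pmf.integrable_const_bound[where B = 1]) (use assms in \<open>auto simp: linear_queries_def\<close>)
  ultimately show ?thesis
    unfolding population_value_def query_value_def by (simp add: integral_sum)
qed

text \<open>Changing one entry outside \<open>J\<close> of a constant dataset alters a single
  summand while the value of the query stays the same, so this summand cannot vary. Dependence of
  the average thus becomes sparsity of its summands.\<close>

lemma depends_on_at_most_constant: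
  fixes q :: "('n::finite, 'x) query"
  assumes "depends_on_at_most k q"
  obtains J where "card J \<le> k" "\<And>i x y. i \<notin> J \<Longrightarrow> q i x = q i y"
proof -
  from assms obtain J where J: "card J \<le> k"
    and eq: "\<And>S S'. (\<forall>j\<in>J. S j = S' j) \<Longrightarrow> query_value q S = query_value q S'"
    unfolding depends_on_at_most_def by blast
  have "q i x = q i y" if "i \<notin> J" for i x y
  proof -
    define S where "S z = (\<lambda>_. x)(i := z)" for z
    have "query_value q (S x) = query_value q (S y)"
      using that by (intro eq) (auto simp: S_def)
    then have "(\<Sum>j\<in>UNIV. q j (S x j)) = (\<Sum>j\<in>UNIV. q j (S y j))"
      by (simp add: query_value_def)
    moreover have "(\<Sum>j\<in>UNIV. q j (S z j)) = q i z + (\<Sum>j\<in>UNIV - {i}. q j x)" for z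
      by (subst sum.remove[of _ i]) (auto simp: S_def)
    ultimately show ?thesis by simp
  qed
  with J that show ?thesis by blast
qed

text \<open>The two tails are upper deviations of \<open>q\<close> and of \<open>1 - q\<close>. Each
  receives \<open>\<eta> / 2\<close>, whence the \<open>2 / \<eta>\<close> in the logarithm.\<close>

lemma nn_integral_query_deviation_le:
  fixes q :: "('n::finite, 'x) query" and w :: "('n, 'x) dataset \<Rightarrow> ennreal"
  assumes q: "q \<in> linear_queries" "depends_on_at_most k q" and K: "K \<ge> 1" and F: "card F \<le> \<kappa>"
    and \<eta>: "0 < \<eta>" "\<eta> < 1"
    and ratio: "\<And>i S x y. i \<notin> F \<Longrightarrow> S \<in> set_pmf (iid_samples P) \<Longrightarrow> x \<in> set_pmf P \<Longrightarrow>
        y \<in> set_pmf P \<Longrightarrow> w (S(i := x)) \<le> ennreal K * w (S(i := y))"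
  shows "(\<integral>\<^sup>+S. indicator {S. \<bar>query_value q S - population_value q P\<bar>
              > real k / real CARD('n) * (K - 1) + real \<kappa> / real CARD('n)
                + 1 / real CARD('n) * sqrt (2 * real k * ln (2 / \<eta>))} S * w S \<partial>iid_samples P)
           \<le> ennreal \<eta> * (\<integral>\<^sup>+S. w S \<partial>iid_samples P)"
proof -
  obtain J where J: "card J \<le> k" and const: "\<And>i x y. i \<notin> J \<Longrightarrow> q i x = q i y"
    using depends_on_at_most_constant[OF q(2)] by blast
  define s where "s = sqrt (2 * real k * ln (2 / \<eta>))"
  define B where "B = real k * (K - 1) + real \<kappa> + s"
  define D where "D \<phi> S = (\<Sum>i\<in>J. \<phi> i (S i) - measure_pmf.expectation P (\<phi> i))"
    for \<phi> :: "('n, 'x) query" and S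
  define q' where "q' i x = 1 - q i x" for i x
  have ln_pos: "ln (2 / \<eta>) > 0" using \<eta> by simp
  have q01: "q i x \<in> {0..1}" for i x using q by (auto simp: linear_queries_def)
  have dev: "query_value q S - population_value q P = 1 / real CARD('n) * D q S" for S
  proof -
    \<comment> \<open>A constant summand equals its mean, so only the indices in \<open>J\<close>
      contribute to the deviation.\<close>
    have "measure_pmf.expectation P (q i) = q i (S i)" if "i \<notin> J" for i
    proof -
      have "q i = (\<lambda>_. q i (S i))" using const[OF that] by blast
      then show ?thesis by (metis measure_pmf.prob_space lebesgue_integral_const scaleR_one)
    qed
    then have "D q S = (\<Sum>i\<in>UNIV. q i (S i) - measure_pmf.expectation P (q i))"
      unfolding D_def by (intro sum.mono_neutral_left) auto
    then show ?thesis
      by (simp add: query_value_def population_value_eq[OF q(1)] sum_subtractf diff_divide_distrib)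
  qed
  have D': "D q' S = - D q S" for S
  proof -
    have "integrable P (q i)" for i
      by (rule measure_pmf.integrable_const_bound[where B = 1]) (use q01 in auto)
    then have "measure_pmf.expectation P (q' i) = 1 - measure_pmf.expectation P (q i)" for i
      by (simp add: q'_def[abs_def])
    then show ?thesis by (simp add: D_def q'_def sum_negf[symmetric])
  qed
  have event: "real k / real CARD('n) * (K - 1) + real \<kappa> / real CARD('n) + 1 / real CARD('n) * s
      < \<bar>query_value q S - population_value q P\<bar> \<longleftrightarrow> B < D q S \<or> B < D q' S" for S
  proof -
    have "real k / real CARD('n) * (K - 1) + real \<kappa> / real CARD('n) + 1 / real CARD('n) * s
        = B / real CARD('n)"
      by (simp add: B_def add_divide_distrib)
    then show ?thesis by (auto simp: dev D' abs_if divide_less_cancel field_simps)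
  qed
  have half: "(\<integral>\<^sup>+S. indicator {S. B < D \<phi> S} S * w S \<partial>iid_samples P)
      \<le> ennreal (\<eta> / 2) * (\<integral>\<^sup>+S. w S \<partial>iid_samples P)" if "\<And>i x. \<phi> i x \<in> {0..1}" for \<phi>
  proof (cases "k = 0")
    case True
    \<comment> \<open>The Chernoff parameter needs \<open>k > 0\<close>. Here the sum over
      \<open>J\<close> is empty and the threshold is nonnegative, so the event is
      impossible.\<close>
    then have "J = {}" using J by simp
    moreover have "B \<ge> 0" using K True by (simp add: B_def s_def)
    ultimately show ?thesis by (simp add: D_def)
  next
    case False
    \<comment> \<open>\<open>s\<close> is chosen so that the Chernoff bound becomes exactly
      \<open>\<eta> / 2\<close>.\<close>
    then have "s > 0" and "s\<^sup>2 / (2 * real k) = ln (2 / \<eta>)"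
      using ln_pos by (simp_all add: s_def)
    moreover have "exp (- ln (2 / \<eta>)) = \<eta> / 2" using \<eta> by (simp add: exp_minus)
    ultimately have "exp (- s\<^sup>2 / (2 * real k)) = \<eta> / 2" by (metis minus_divide_left)
    moreover have "(\<integral>\<^sup>+S. indicator {S. B < D \<phi> S} S * w S \<partial>iid_samples P)
        \<le> ennreal (exp (- s\<^sup>2 / (2 * real k))) * (\<integral>\<^sup>+S. w S \<partial>iid_samples P)"
      unfolding D_def B_def
      by (rule nn_integral_iid_samples_deviation_le[where F = F])
         (use that K J F False \<open>s > 0\<close> ratio in auto)
    ultimately show ?thesis by (simp only:)
  qed
  have "(\<integral>\<^sup>+S. indicator {S. \<bar>query_value q S - population_value q P\<bar>
              > real k / real CARD('n) * (K - 1) + real \<kappa> / real CARD('n)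
                + 1 / real CARD('n) * s} S * w S \<partial>iid_samples P)
      \<le> (\<integral>\<^sup>+S. indicator {S. B < D q S} S * w S + indicator {S. B < D q' S} S * w S \<partial>iid_samples P)"
    unfolding event by (intro nn_integral_mono) (auto split: split_indicator)
  also have "\<dots> \<le> ennreal (\<eta> / 2) * (\<integral>\<^sup>+S. w S \<partial>iid_samples P)
      + ennreal (\<eta> / 2) * (\<integral>\<^sup>+S. w S \<partial>iid_samples P)"
    by (subst nn_integral_add, simp, simp, intro add_mono half) (use q01 in \<open>auto simp: q'_def\<close>)
  also have "\<dots> = ennreal \<eta> * (\<integral>\<^sup>+S. w S \<partial>iid_samples P)"
    using \<eta> by (simp add: distrib_right[symmetric] ennreal_plus[symmetric] del: ennreal_plus)
  finally show ?thesis unfolding s_def .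
qed

section \<open>The interaction as a composition of probability kernels\<close>

lemma bind_in_space_prob_algebra:
  assumes "A \<in> space (prob_algebra N)" "g \<in> N \<rightarrow>\<^sub>M prob_algebra R"
  shows "A \<bind> g \<in> space (prob_algebra R)"
  using prob_space_bind'[OF assms] sets_bind'[OF assms] by (simp add: space_prob_algebra)

text \<open>The integral formulas for \<open>bind\<close> require measurable probability kernels,
  which is checked round by round.\<close>

lemma run_in_space_prob_algebra:
  assumes M: "is_mechanism Q M" and A: "is_adversary Q A"
  shows "run Q M A S t \<in> space (prob_algebra (transcript_space Q t \<Otimes>\<^sub>M state_space M))"
proof (induction t)
  case 0
  \<comment> \<open>A product over the empty index set has this function as its only point.\<close>
  have "(\<lambda>_. undefined) \<in> space (transcript_space Q 0)"
    by (simp add: transcript_space_def space_PiM)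
  then have "(\<lambda>s. return (transcript_space Q 0 \<Otimes>\<^sub>M state_space M) (\<lambda>_. undefined, s))
      \<in> state_space M \<rightarrow>\<^sub>M prob_algebra (transcript_space Q 0 \<Otimes>\<^sub>M state_space M)"
    by measurable
  with M show ?case
    by (auto simp: is_mechanism_def intro!: bind_in_space_prob_algebra)
next
  case (Suc t)
  have [measurable]: "A t \<in> transcript_space Q t \<rightarrow>\<^sub>M prob_algebra (query_space Q)"
    using A by (simp add: is_adversary_def)
  have [measurable]: "(\<lambda>(s, q). answer M s q) \<in>
      state_space M \<Otimes>\<^sub>M query_space Q \<rightarrow>\<^sub>M prob_algebra (borel \<Otimes>\<^sub>M state_space M)"
    using M by (simp add: is_mechanism_def)
  have [measurable]: "(\<lambda>(h, qa). h(t := qa)) \<in>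
      transcript_space Q t \<Otimes>\<^sub>M (query_space Q \<Otimes>\<^sub>M borel) \<rightarrow>\<^sub>M transcript_space Q (Suc t)"
    unfolding transcript_space_def lessThan_Suc by (rule measurable_add_dim)
  have "(\<lambda>(h, s). A t h \<bind> (\<lambda>q. answer M s q \<bind> (\<lambda>(a, s').
           return (transcript_space Q (Suc t) \<Otimes>\<^sub>M state_space M) (h(t := (q, a)), s'))))
      \<in> transcript_space Q t \<Otimes>\<^sub>M state_space M
        \<rightarrow>\<^sub>M prob_algebra (transcript_space Q (Suc t) \<Otimes>\<^sub>M state_space M)"
    by measurable
  with Suc show ?case
    by (simp add: bind_in_space_prob_algebra)
qed

lemma interaction_in_space_prob_algebra:
  assumes "is_mechanism Q M" "is_adversary Q A"
  shows "interaction Q T M A S \<in> space (prob_algebra (transcript_space Q T))"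
  unfolding interaction_def
  using run_in_space_prob_algebra[OF assms]
  by (rule measurable_space[OF measurable_distr_prob_space, rotated]) simp

text \<open>Datasets carry the discrete sigma-algebra, so any family of laws indexed by them is a
  kernel and the joint law disintegrates over the sampled dataset.\<close>

lemma
  fixes P :: "'x::countable pmf" and Q :: "('n::finite, 'x) query set"
  assumes M: "is_mechanism Q M" and A: "is_adversary Q A"
  shows sample_and_interact_in_space_prob_algebra:
      "sample_and_interact Q T M A P
         \<in> space (prob_algebra (count_space UNIV \<Otimes>\<^sub>M transcript_space Q T))"
    and emeasure_sample_and_interact:
      "E \<in> sets (count_space UNIV \<Otimes>\<^sub>M transcript_space Q T) \<Longrightarrow>
       emeasure (sample_and_interact Q T M A P) E
         = (\<integral>\<^sup>+S. emeasure (interaction Q T M A S) (Pair S -` E) \<partial>iid_samples P)"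
proof -
  let ?N = "transcript_space Q T"
  let ?R = "count_space UNIV \<Otimes>\<^sub>M ?N"
  have int: "interaction Q T M A S \<in> space (prob_algebra ?N)" for S
    by (rule interaction_in_space_prob_algebra[OF M A])
  have sets_int[measurable_cong, simp]: "sets (interaction Q T M A S) = sets ?N" for S
    using int[of S] by (simp add: space_prob_algebra)
  have space_int: "space (interaction Q T M A S) = space ?N" for S
    by (rule sets_eq_imp_space_eq) simp
  define k where "k S = interaction Q T M A S \<bind> (\<lambda>\<pi>. return ?R (S, \<pi>))" for S
  have k_in: "k S \<in> space (prob_algebra ?R)" for S
    unfolding k_def by (rule bind_in_space_prob_algebra[OF int]) measurable
  have meas: "k \<in> count_space UNIV \<rightarrow>\<^sub>M prob_algebra ?R"
    using k_in by auto
  have p: "measure_pmf (iid_samples P) \<in> space (prob_algebra (count_space UNIV))"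
    by (simp add: space_prob_algebra measure_pmf.prob_space_axioms)
  have eq: "sample_and_interact Q T M A P = measure_pmf (iid_samples P) \<bind> k"
    by (simp add: sample_and_interact_def k_def[abs_def])
  show "sample_and_interact Q T M A P \<in> space (prob_algebra ?R)"
    unfolding eq by (rule bind_in_space_prob_algebra[OF p meas])
  assume E: "E \<in> sets ?R"
  have "emeasure (k S) E = emeasure (interaction Q T M A S) (Pair S -` E)" for S
  proof -
    have "emeasure (k S) E = (\<integral>\<^sup>+\<pi>. emeasure (return ?R (S, \<pi>)) E \<partial>interaction Q T M A S)"
      unfolding k_def by (rule emeasure_bind_prob_algebra[OF int _ E]) measurable
    also have "\<dots> = (\<integral>\<^sup>+\<pi>. indicator (Pair S -` E) \<pi> \<partial>interaction Q T M A S)"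
      using E by (intro nn_integral_cong) (auto split: split_indicator)
    also have "\<dots> = emeasure (interaction Q T M A S) (Pair S -` E)"
      using sets_Pair1[OF E] by (intro nn_integral_indicator) simp
    finally show ?thesis .
  qed
  then show "emeasure (sample_and_interact Q T M A P) E
      = (\<integral>\<^sup>+S. emeasure (interaction Q T M A S) (Pair S -` E) \<partial>iid_samples P)"
    unfolding eq by (simp add: emeasure_bind_prob_algebra[OF p meas E])
qed

section \<open>Densities of transcript laws and the pointwise form of privacy\<close>

text \<open>Every dataset in the support has positive mass, so null sets of the mixture are null for
  its law and Radon-Nikodym applies. The common base measure makes different datasets comparable at
  one and the same transcript.\<close>

lemma pmf_mixture_densities:
  fixes p :: "'s pmf" and \<mu> :: "'s \<Rightarrow> 'a measure"
  assumes \<mu>: "\<And>S. \<mu> S \<in> space (prob_algebra N)"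
  obtains \<nu> g where "prob_space \<nu>" "sets \<nu> = sets N" "\<And>S. g S \<in> borel_measurable N"
    "\<And>S. S \<in> set_pmf p \<Longrightarrow> \<mu> S = density \<nu> (g S)"
proof -
  define \<nu> where "\<nu> = measure_pmf p \<bind> \<mu>"
  have p: "measure_pmf p \<in> space (prob_algebra (count_space UNIV))"
    by (simp add: space_prob_algebra measure_pmf.prob_space_axioms)
  have meas: "\<mu> \<in> count_space UNIV \<rightarrow>\<^sub>M prob_algebra N" using \<mu> by auto
  have "\<nu> \<in> space (prob_algebra N)"
    unfolding \<nu>_def by (rule bind_in_space_prob_algebra[OF p meas])
  then have \<nu>: "prob_space \<nu>" "sets \<nu> = sets N" by (auto simp: space_prob_algebra)
  interpret \<nu>: prob_space \<nu> by (rule \<nu>(1))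
  have "\<exists>g\<in>borel_measurable N. S \<in> set_pmf p \<longrightarrow> \<mu> S = density \<nu> g" for S
  proof (cases "S \<in> set_pmf p")
    case True
    have sets_\<mu>: "sets (\<mu> S) = sets N" using \<mu> by (simp add: space_prob_algebra)
    have "absolutely_continuous \<nu> (\<mu> S)"
      unfolding absolutely_continuous_def
    proof
      fix E assume "E \<in> null_sets \<nu>"
      then have E: "E \<in> sets N" "emeasure \<nu> E = 0" using \<nu>(2) by auto
      then have "(\<integral>\<^sup>+S. emeasure (\<mu> S) E \<partial>p) = 0"
        by (simp add: \<nu>_def emeasure_bind_prob_algebra[OF p meas])
      then have "AE S in p. emeasure (\<mu> S) E = 0"
        by (subst (asm) nn_integral_0_iff_AE) auto
      with True E sets_\<mu> show "E \<in> null_sets (\<mu> S)"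
        by (auto simp: AE_measure_pmf_iff)
    qed
    then obtain g where "g \<in> borel_measurable \<nu>" "density \<nu> g = \<mu> S"
      using \<nu>.Radon_Nikodym[of "\<mu> S"] \<nu>(2) sets_\<mu> by auto
    then have "g \<in> borel_measurable N" "\<mu> S = density \<nu> g"
      using \<nu>(2) by (simp_all cong: measurable_cong_sets)
    then show ?thesis by blast
  next
    case False
    \<comment> \<open>Off the support only measurability is claimed, so the zero function
      serves.\<close>
    then show ?thesis by (intro bexI[of _ "\<lambda>_. 0"]) auto
  qed
  then obtain g where "\<And>S. g S \<in> borel_measurable N" "\<And>S. S \<in> set_pmf p \<Longrightarrow> \<mu> S = density \<nu> (g S)"
    by metis
  with \<nu> that show ?thesis by blast
qed

text \<open>The set of points of \<open>B\<close> where the pointwise inequality fails is itself an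
  admissible event. If it were not null, the two integrals over it would be strictly ordered against
  the hypothesis; finiteness makes this comparison strict.\<close>

lemma AE_density_le_of_measure_le:
  fixes g1 g2 :: "'a \<Rightarrow> ennreal"
  assumes \<nu>: "finite_measure (density \<nu> g1)" "finite_measure (density \<nu> g2)"
    and [measurable]: "g1 \<in> borel_measurable \<nu>" "g2 \<in> borel_measurable \<nu>" "B \<in> sets \<nu>"
    and K: "K \<ge> 0"
    and le: "\<And>E. E \<in> sets \<nu> \<Longrightarrow> E \<subseteq> B \<Longrightarrow>
      measure (density \<nu> g1) E \<le> K * measure (density \<nu> g2) E"
  shows "AE x in \<nu>. x \<in> B \<longrightarrow> g1 x \<le> ennreal K * g2 x"
proof -
  interpret m1: finite_measure "density \<nu> g1" by fact
  interpret m2: finite_measure "density \<nu> g2" by fact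
  define E where "E = {x \<in> space \<nu>. x \<in> B \<and> ennreal K * g2 x < g1 x}"
  have E[measurable]: "E \<in> sets \<nu>" unfolding E_def by measurable
  have int: "(\<integral>\<^sup>+x. g1 x * indicator E x \<partial>\<nu>) = emeasure (density \<nu> g1) E"
      "(\<integral>\<^sup>+x. ennreal K * (g2 x * indicator E x) \<partial>\<nu>) = ennreal K * emeasure (density \<nu> g2) E"
    by (simp_all add: emeasure_density nn_integral_cmult)
  have "emeasure (density \<nu> g1) E \<le> ennreal (K * measure (density \<nu> g2) E)"
    unfolding m1.emeasure_eq_measure by (intro ennreal_leI le) (auto simp: E_def)
  then have int_le: "(\<integral>\<^sup>+x. g1 x * indicator E x \<partial>\<nu>) \<le> (\<integral>\<^sup>+x. ennreal K * (g2 x * indicator E x) \<partial>\<nu>)"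
    unfolding int using K by (simp add: m2.emeasure_eq_measure ennreal_mult)
  have "AE x in \<nu>. g1 x * indicator E x \<le> ennreal K * (g2 x * indicator E x)"
  proof (rule ccontr)
    assume "\<not> ?thesis"
    then have "(\<integral>\<^sup>+x. ennreal K * (g2 x * indicator E x) \<partial>\<nu>) < (\<integral>\<^sup>+x. g1 x * indicator E x \<partial>\<nu>)"
    proof (intro nn_integral_less)
      show "(\<integral>\<^sup>+x. ennreal K * (g2 x * indicator E x) \<partial>\<nu>) \<noteq> \<infinity>"
        unfolding int using K by (simp add: m2.emeasure_eq_measure ennreal_mult[symmetric])
      show "AE x in \<nu>. ennreal K * (g2 x * indicator E x) \<le> g1 x * indicator E x"
        by (auto simp: E_def split: split_indicator)
    qed auto
    with int_le show False by simp
  qed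
  moreover have "AE x in \<nu>. x \<in> space \<nu>" by simp
  ultimately show ?thesis
    by eventually_elim (auto simp: E_def indicator_def intro: leI)
qed

section \<open>Measurability of the sample error\<close>

lemma measurable_query_value:
  fixes Q :: "('n::finite, 'x::countable) query set"
  shows "(\<lambda>q. query_value q S) \<in> borel_measurable (query_space Q)"
proof -
  have "(\<lambda>q :: ('n, 'x) query. q i (S i)) \<in> borel_measurable borel" for i :: 'n
    by (rule borel_measurable_continuous_onI)
       (rule continuous_on_product_then_coordinatewise[OF continuous_on_product_coordinates])
  then have "(\<lambda>q :: ('n, 'x) query. query_value q S) \<in> borel_measurable borel"
    unfolding query_value_def by measurable
  then show ?thesis
    unfolding query_space_def by (rule measurable_restrict_space1)
qed

text \<open>There are countably many datasets, so joint measurability can be checked for each fixed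
  dataset. Having at least one round keeps the maximum over a nonempty set.\<close>

lemma sets_query_sample_error_ge:
  fixes Q :: "('n::finite, 'x::countable) query set" and T :: nat
  assumes "0 < T"
  shows "{(S, \<pi>). (S, \<pi>) \<in> space (count_space UNIV \<Otimes>\<^sub>M transcript_space Q T) \<and>
      (MAX t\<in>{..<T}. \<bar>snd (\<pi> t) - query_value (fst (\<pi> t)) S\<bar>) \<ge> \<alpha>}
    \<in> sets (count_space UNIV \<Otimes>\<^sub>M transcript_space Q T)"
proof -
  have "(\<lambda>\<pi>. MAX t\<in>{..<T}. \<bar>snd (\<pi> t) - query_value (fst (\<pi> t)) S\<bar>)
      \<in> borel_measurable (transcript_space Q T)" for S
  proof (rule borel_measurable_Max)
    fix t assume t: "t \<in> {..<T}"
    then have [measurable]: "(\<lambda>\<pi>. \<pi> t) \<in> transcript_space Q T \<rightarrow>\<^sub>M query_space Q \<Otimes>\<^sub>M borel"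
      unfolding transcript_space_def by (rule measurable_component_singleton)
    note measurable_query_value[of S Q, measurable]
    show "(\<lambda>\<pi>. \<bar>snd (\<pi> t) - query_value (fst (\<pi> t)) S\<bar>) \<in> borel_measurable (transcript_space Q T)"
      by measurable
  qed (use assms in auto)
  then have "(\<lambda>(S, \<pi>). MAX t\<in>{..<T}. \<bar>snd (\<pi> t) - query_value (fst (\<pi> t)) S\<bar>)
      \<in> borel_measurable (count_space UNIV \<Otimes>\<^sub>M transcript_space Q T)"
    by (intro measurable_pair_measure_countable1) auto
  from borel_measurable_le[OF measurable_const this] show ?thesis
    by (simp add: case_prod_beta')
qed

section \<open>From privacy to the gap between sample and population values\<close>

text \<open>The order of integration is exchanged, so that the transcript is fixed first. The
  deviating query is selected from the transcript alone and is therefore fixed while the dataset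
  varies, which reduces the claim to the bound for a single query.\<close>

lemma partial_DP_error_transfer:
  fixes Q :: "('n::finite, 'x::countable) query set" and P :: "'x pmf"
  assumes \<epsilon>: "0 \<le> \<epsilon>" and lin: "Q \<subseteq> linear_queries"
    and dep: "\<And>q. q \<in> Q \<Longrightarrow> depends_on_at_most k q"
    and M: "is_mechanism Q M" and DP: "partial_DP Q T M \<epsilon> 0 \<kappa>" and A: "is_adversary Q A"
    and \<eta>: "0 < \<eta>" "\<eta> < 1"
    and E: "E \<in> sets (count_space UNIV \<Otimes>\<^sub>M transcript_space Q T)"
    and E_deviates: "\<And>\<pi>. \<pi> \<in> space (transcript_space Q T) \<Longrightarrow> \<exists>q\<in>Q. \<forall>S. (S, \<pi>) \<in> E \<longrightarrow>
      \<bar>query_value q S - population_value q P\<bar>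
        > real k / real CARD('n) * (exp \<epsilon> - 1) + real \<kappa> / real CARD('n)
          + 1 / real CARD('n) * sqrt (2 * real k * ln (2 / \<eta>))"
  shows "measure (sample_and_interact Q T M A P) E \<le> \<eta>"
proof -
  let ?N = "transcript_space Q T"
  let ?p = "iid_samples P :: ('n, 'x) dataset pmf"
  have \<mu>: "interaction Q T M A S \<in> space (prob_algebra ?N)" for S
    by (rule interaction_in_space_prob_algebra[OF M A])
  obtain \<nu> g where \<nu>: "prob_space \<nu>" "sets \<nu> = sets ?N" and g: "\<And>S. g S \<in> borel_measurable ?N"
    and dens: "\<And>S. S \<in> set_pmf ?p \<Longrightarrow> interaction Q T M A S = density \<nu> (g S)"
    using pmf_mixture_densities[of "interaction Q T M A" ?N ?p] \<mu> by blast
  interpret \<nu>: prob_space \<nu> by (rule \<nu>(1))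
  interpret pair_sigma_finite "measure_pmf ?p" \<nu> ..
  have g_meas[measurable]: "g S \<in> borel_measurable \<nu>" for S
    using g \<nu>(2) by (simp cong: measurable_cong_sets)
  have space_\<nu>: "space \<nu> = space ?N" using \<nu>(2) by (rule sets_eq_imp_space_eq)
  have prob: "prob_space (density \<nu> (g S))" if "S \<in> set_pmf ?p" for S
    using \<mu>[of S] dens[OF that] by (simp add: space_prob_algebra)
  obtain f where f: "f \<in> ?N \<rightarrow>\<^sub>M count_space UNIV" and card_f: "\<And>\<pi>. \<pi> \<in> space ?N \<Longrightarrow> card (f \<pi>) \<le> \<kappa>"
    and priv: "\<And>i S S' E. (\<forall>j. j \<noteq> i \<longrightarrow> S j = S' j) \<Longrightarrow> E \<in> sets ?N \<Longrightarrow> i \<notin> (\<Union>\<pi>\<in>E. f \<pi>) \<Longrightarrow>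
      measure (interaction Q T M A S) E \<le> exp \<epsilon> * measure (interaction Q T M A S') E"
    using DP A unfolding partial_DP_def by auto
  have "AE \<pi> in \<nu>. \<pi> \<in> {\<pi> \<in> space ?N. i \<notin> f \<pi>} \<longrightarrow> g S \<pi> \<le> ennreal (exp \<epsilon>) * g S' \<pi>"
    if S: "S \<in> set_pmf ?p" "S' \<in> set_pmf ?p" "\<forall>j. j \<noteq> i \<longrightarrow> S j = S' j" for i S S'
  proof (rule AE_density_le_of_measure_le)
    show "finite_measure (density \<nu> (g S))" "finite_measure (density \<nu> (g S'))"
      using prob[OF S(1)] prob[OF S(2)] by (simp_all add: prob_space_def)
    have "f -` {F. i \<notin> F} \<inter> space ?N \<in> sets ?N" using f by (rule measurable_sets) simp
    also have "f -` {F. i \<notin> F} \<inter> space ?N = {\<pi> \<in> space ?N. i \<notin> f \<pi>}" by auto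
    finally show "{\<pi> \<in> space ?N. i \<notin> f \<pi>} \<in> sets \<nu>" by (simp add: \<nu>(2))
  next
    fix E assume "E \<in> sets \<nu>" "E \<subseteq> {\<pi> \<in> space ?N. i \<notin> f \<pi>}"
    then show "measure (density \<nu> (g S)) E \<le> exp \<epsilon> * measure (density \<nu> (g S')) E"
      using priv[OF S(3), of E] \<nu>(2) dens[OF S(1)] dens[OF S(2)] by auto
  qed simp_all
  \<comment> \<open>There are countably many triples of an index and two datasets, so one null set
    serves all of them.\<close>
  then have "AE \<pi> in \<nu>. \<forall>i S S'. S \<in> set_pmf ?p \<longrightarrow> S' \<in> set_pmf ?p \<longrightarrow> (\<forall>j. j \<noteq> i \<longrightarrow> S j = S' j) \<longrightarrow>
      \<pi> \<in> {\<pi> \<in> space ?N. i \<notin> f \<pi>} \<longrightarrow> g S \<pi> \<le> ennreal (exp \<epsilon>) * g S' \<pi>"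
    by (simp add: AE_all_countable)
  then have pointwise: "AE \<pi> in \<nu>. (\<integral>\<^sup>+S. indicator E (S, \<pi>) * g S \<pi> \<partial>?p) \<le> ennreal \<eta> * (\<integral>\<^sup>+S. g S \<pi> \<partial>?p)"
    using AE_space
  proof eventually_elim
    case (elim \<pi>)
    then have \<pi>: "\<pi> \<in> space ?N" by (simp add: space_\<nu>)
    obtain q where q: "q \<in> Q" and dev: "\<And>S. (S, \<pi>) \<in> E \<Longrightarrow>
      \<bar>query_value q S - population_value q P\<bar>
        > real k / real CARD('n) * (exp \<epsilon> - 1) + real \<kappa> / real CARD('n)
          + 1 / real CARD('n) * sqrt (2 * real k * ln (2 / \<eta>))"
      using E_deviates[OF \<pi>] by blast
    have "(\<integral>\<^sup>+S. indicator E (S, \<pi>) * g S \<pi> \<partial>?p)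
      \<le> (\<integral>\<^sup>+S. indicator {S. \<bar>query_value q S - population_value q P\<bar>
              > real k / real CARD('n) * (exp \<epsilon> - 1) + real \<kappa> / real CARD('n)
                + 1 / real CARD('n) * sqrt (2 * real k * ln (2 / \<eta>))} S * g S \<pi> \<partial>?p)"
      by (intro nn_integral_mono mult_right_mono) (use dev in \<open>auto split: split_indicator\<close>)
    also have "\<dots> \<le> ennreal \<eta> * (\<integral>\<^sup>+S. g S \<pi> \<partial>?p)"
    proof (rule nn_integral_query_deviation_le[where F = "f \<pi>"])
      fix i and S :: "('n, 'x) dataset" and x y
      assume S: "i \<notin> f \<pi>" "S \<in> set_pmf ?p" "x \<in> set_pmf P" "y \<in> set_pmf P"
      \<comment> \<open>Both modified datasets stay in the support, where \<open>g\<close> is known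
        to be a density of the transcript law.\<close>
      then have "S(i := x) \<in> set_pmf ?p" "S(i := y) \<in> set_pmf ?p"
        by (auto simp: iid_samples_def set_Pi_pmf PiE_dflt_def)
      moreover have "\<forall>j. j \<noteq> i \<longrightarrow> (S(i := x)) j = (S(i := y)) j" by simp
      moreover have "\<pi> \<in> {\<pi> \<in> space ?N. i \<notin> f \<pi>}" using S(1) \<pi> by simp
      ultimately show "g (S(i := x)) \<pi> \<le> ennreal (exp \<epsilon>) * g (S(i := y)) \<pi>"
        using elim(1) by blast
    qed (use q lin dep \<epsilon> \<eta> card_f[OF \<pi>] in auto)
    finally show ?case .
  qed
  have E_sec: "Pair S -` E \<in> sets \<nu>" for S using sets_Pair1[OF E] by (simp add: \<nu>(2))
  have swap: "(\<integral>\<^sup>+S. \<integral>\<^sup>+\<pi>. h S \<pi> \<partial>\<nu> \<partial>?p) = (\<integral>\<^sup>+\<pi>. \<integral>\<^sup>+S. h S \<pi> \<partial>?p \<partial>\<nu>)"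
    if "\<And>S. h S \<in> borel_measurable \<nu>" for h
  proof (rule Fubini'[symmetric])
    have "case_prod h \<in> borel_measurable (count_space UNIV \<Otimes>\<^sub>M \<nu>)"
      by (rule measurable_pair_measure_countable1) (use that in auto)
    then show "case_prod h \<in> borel_measurable (measure_pmf ?p \<Otimes>\<^sub>M \<nu>)"
      by (simp cong: measurable_cong_sets sets_pair_measure_cong)
  qed
  have "emeasure (sample_and_interact Q T M A P) E
      = (\<integral>\<^sup>+S. emeasure (interaction Q T M A S) (Pair S -` E) \<partial>?p)"
    by (rule emeasure_sample_and_interact[OF M A E])
  also have "\<dots> = (\<integral>\<^sup>+S. \<integral>\<^sup>+\<pi>. indicator E (S, \<pi>) * g S \<pi> \<partial>\<nu> \<partial>?p)"
    by (intro nn_integral_cong_AE)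
       (auto simp: AE_measure_pmf_iff dens emeasure_density E_sec intro!: nn_integral_cong
         split: split_indicator)
  also have "\<dots> = (\<integral>\<^sup>+\<pi>. \<integral>\<^sup>+S. indicator E (S, \<pi>) * g S \<pi> \<partial>?p \<partial>\<nu>)"
  proof (rule swap)
    fix S
    have "(\<lambda>\<pi>. indicator (Pair S -` E) \<pi> * g S \<pi>) \<in> borel_measurable \<nu>"
      using E_sec[of S] by measurable
    then show "(\<lambda>\<pi>. indicator E (S, \<pi>) * g S \<pi>) \<in> borel_measurable \<nu>"
      by (simp add: indicator_def)
  qed
  also have "\<dots> \<le> (\<integral>\<^sup>+\<pi>. ennreal \<eta> * (\<integral>\<^sup>+S. g S \<pi> \<partial>?p) \<partial>\<nu>)"
    by (rule nn_integral_mono_AE[OF pointwise])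
  also have "\<dots> = (\<integral>\<^sup>+\<pi>. \<integral>\<^sup>+S. ennreal \<eta> * g S \<pi> \<partial>?p \<partial>\<nu>)"
    by (simp add: nn_integral_cmult)
  also have "\<dots> = (\<integral>\<^sup>+S. \<integral>\<^sup>+\<pi>. ennreal \<eta> * g S \<pi> \<partial>\<nu> \<partial>?p)"
    by (rule swap[symmetric]) measurable
  \<comment> \<open>Each density on the support integrates to \<open>1\<close> over transcripts, so
    only the factor \<open>\<eta>\<close> remains.\<close>
  also have "\<dots> = (\<integral>\<^sup>+S. ennreal \<eta> \<partial>?p)"
  proof (intro nn_integral_cong_AE, unfold AE_measure_pmf_iff, intro ballI)
    fix S assume "S \<in> set_pmf ?p"
    from prob_space.emeasure_space_1[OF prob[OF this]]
    have "(\<integral>\<^sup>+\<pi>. g S \<pi> \<partial>\<nu>) = 1" by (simp add: emeasure_density cong: nn_integral_cong)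
    then show "(\<integral>\<^sup>+\<pi>. ennreal \<eta> * g S \<pi> \<partial>\<nu>) = ennreal \<eta>" by (simp add: nn_integral_cmult)
  qed
  also have "\<dots> = ennreal \<eta>" by simp
  finally show ?thesis
    unfolding measure_def using \<eta> by (simp add: enn2real_leI)
qed

section \<open>Union bound over sample inaccuracy and deviation from the population\<close>

theorem theorem7:
  fixes Q :: "('n::finite, 'x::countable) query set"
    and M :: "('n, 'x, 's) mechanism"
    and T \<kappa> mhat :: nat
    and \<epsilon> \<alpha> \<beta> :: real
  assumes "0 < T"
    and "0 \<le> \<epsilon>"
    and "Q \<subseteq> linear_queries"
    and "\<And>q. q \<in> Q \<Longrightarrow> depends_on_at_most mhat q"
    and "is_mechanism Q M"
    and "partial_DP Q T M \<epsilon> 0 \<kappa>"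
    and "sample_accurate Q T M \<alpha> \<beta>"
  shows "\<forall>(P :: 'x pmf) A (\<eta> :: real). is_adversary Q A \<longrightarrow> \<eta> > 0 \<longrightarrow>
    \<P>((S, \<pi>) in sample_and_interact Q T M A P.
       (MAX t\<in>{..<T}. \<bar>snd (\<pi> t) - population_value (fst (\<pi> t)) P\<bar>)
         > \<alpha> + real mhat / real CARD('n) * (exp \<epsilon> - 1) + real \<kappa> / real CARD('n)
             + 1 / real CARD('n) * sqrt (2 * real mhat * ln (2 / \<eta>)))
    \<le> \<beta> + \<eta>"
proof (intro allI impI)
  fix P :: "'x pmf" and A and \<eta> :: real
  assume A: "is_adversary Q A" and \<eta>: "\<eta> > 0"
  let ?R = "count_space UNIV \<Otimes>\<^sub>M transcript_space Q T :: (('n, 'x) dataset \<times> ('n, 'x) transcript) measure"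
  let ?X = "sample_and_interact Q T M A P"
  define \<tau> where "\<tau> = real mhat / real CARD('n) * (exp \<epsilon> - 1) + real \<kappa> / real CARD('n)
             + 1 / real CARD('n) * sqrt (2 * real mhat * ln (2 / \<eta>))"
  define D where "D t \<pi> = \<bar>snd (\<pi> t) - population_value (fst (\<pi> t)) P\<bar>"
    for t and \<pi> :: "('n, 'x) transcript"
  define L where "L t S \<pi> = \<bar>snd (\<pi> t) - query_value (fst (\<pi> t)) S\<bar>"
    for t S and \<pi> :: "('n, 'x) transcript"
  define E where "E = {(S, \<pi>). (S, \<pi>) \<in> space ?R \<and> (MAX t\<in>{..<T}. D t \<pi>) > \<alpha> + \<tau>}"
  define B where "B = {(S, \<pi>). (S, \<pi>) \<in> space ?R \<and> (MAX t\<in>{..<T}. L t S \<pi>) \<ge> \<alpha>}"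
  have X: "?X \<in> space (prob_algebra ?R)"
    by (rule sample_and_interact_in_space_prob_algebra[OF assms(5) A])
  then interpret X: prob_space ?X by (simp add: space_prob_algebra)
  have sets_X: "sets ?X = sets ?R" using X by (simp add: space_prob_algebra)
  have space_X: "space ?X = space ?R" using sets_X by (rule sets_eq_imp_space_eq)
  have B: "B \<in> sets ?R"
    unfolding B_def L_def by (rule sets_query_sample_error_ge[OF assms(1)])
  have B_le: "measure ?X B \<le> \<beta>"
    using assms(7) A unfolding sample_accurate_def B_def L_def space_X[symmetric] by simp
  \<comment> \<open>With \<open>\<beta>\<close> nonnegative, the claim is immediate for
    \<open>\<eta> \<ge> 1\<close>.\<close>
  then have \<beta>: "\<beta> \<ge> 0" using measure_nonneg[of ?X B] by linarith
  have "measure ?X E \<le> \<beta> + \<eta>"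
  proof (cases "E \<in> sets ?R \<and> \<eta> < 1")
    case False
    then consider "E \<notin> sets ?X" | "\<eta> \<ge> 1"
      unfolding sets_X by linarith
    then show ?thesis
    proof cases
      \<comment> \<open>Measurability of \<open>E\<close> is not needed: a non-measurable set has measure \<open>0\<close> by convention.\<close>
      case 1
      then show ?thesis using \<beta> \<eta> measure_notin_sets[OF 1] by linarith
    next
      case 2
      then show ?thesis using \<beta> X.prob_le_1[of E] by linarith
    qed
  next
    case True
    have "measure ?X (E - B) \<le> \<eta>"
    proof (rule partial_DP_error_transfer[OF assms(2-6) A \<eta>])
      fix \<pi> assume \<pi>: "\<pi> \<in> space (transcript_space Q T)"
      then have q: "fst (\<pi> t) \<in> Q" if "t < T" for t
        using that by (auto simp: transcript_space_def query_space_def space_PiM space_pair_measure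
          space_restrict_space PiE_iff mem_Times_iff)
      have "\<exists>q\<in>Q. \<forall>S. (S, \<pi>) \<in> E - B \<longrightarrow> \<bar>query_value q S - population_value q P\<bar> > \<tau>"
      \<comment> \<open>\<open>D t \<pi>\<close> does not involve the dataset, so the round, and
        with it the query, can be chosen from the transcript alone.\<close>
      proof (cases "\<exists>t<T. D t \<pi> > \<alpha> + \<tau>")
        case True
        then obtain t where t: "t < T" "D t \<pi> > \<alpha> + \<tau>" by blast
        \<comment> \<open>Outside \<open>B\<close> every sample error is below
          \<open>\<alpha>\<close>, while the population error in round \<open>t\<close> exceeds
          \<open>\<alpha> + \<tau>\<close>; the triangle inequality leaves a gap above
          \<open>\<tau>\<close>.\<close>
        have "\<tau> < \<bar>query_value (fst (\<pi> t)) S - population_value (fst (\<pi> t)) P\<bar>"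
          if "(S, \<pi>) \<in> E - B" for S
        proof -
          have "(MAX t\<in>{..<T}. L t S \<pi>) < \<alpha>"
            using that by (auto simp: E_def B_def)
          moreover have "L t S \<pi> \<le> (MAX t\<in>{..<T}. L t S \<pi>)"
            using t by (intro Max_ge) auto
          ultimately show ?thesis using t(2) by (simp add: D_def L_def)
        qed
        with q[OF t(1)] show ?thesis by blast
      next
        case False
        \<comment> \<open>No dataset is paired with this transcript in \<open>E\<close>, so any
          query qualifies, and that of round \<open>0\<close> exists because
          \<open>0 < T\<close>.\<close>
        then have "(MAX t\<in>{..<T}. D t \<pi>) \<le> \<alpha> + \<tau>"
          using assms(1) by (subst Max_le_iff) (fastforce simp: not_less not_le)+
        with q[OF assms(1)] show ?thesis by (auto simp: E_def)
      qed
      then show "\<exists>q\<in>Q. \<forall>S. (S, \<pi>) \<in> E - B \<longrightarrow> \<bar>query_value q S - population_value q P\<bar>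
        > real mhat / real CARD('n) * (exp \<epsilon> - 1) + real \<kappa> / real CARD('n)
          + 1 / real CARD('n) * sqrt (2 * real mhat * ln (2 / \<eta>))"
        unfolding \<tau>_def .
    qed (use True B in auto)
    moreover have "measure ?X E \<le> measure ?X (B \<union> (E - B))"
      using True B sets_X by (intro X.finite_measure_mono) auto
    moreover have "measure ?X (B \<union> (E - B)) \<le> measure ?X B + measure ?X (E - B)"
      using True B sets_X by (intro measure_Un_le) auto
    ultimately show ?thesis using B_le by linarith
  qed
  then show "\<P>((S, \<pi>) in ?X.
       (MAX t\<in>{..<T}. \<bar>snd (\<pi> t) - population_value (fst (\<pi> t)) P\<bar>)
         > \<alpha> + real mhat / real CARD('n) * (exp \<epsilon> - 1) + real \<kappa> / real CARD('n)
             + 1 / real CARD('n) * sqrt (2 * real mhat * ln (2 / \<eta>)))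
    \<le> \<beta> + \<eta>"
    unfolding E_def D_def \<tau>_def space_X by (simp add: add.assoc)
qed

end
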